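(* Let $G$ be a directed graph rooted in a vertex $r$ and let $A$ be an arborescence of $G$ rooted in $r$ such that $A$ has degree one in the flip graph $\mathcal{F}_r(G)$, its unique neighbour being obtained from $A$ by flipping in some arc $uv$. Then $G-uv$ is built on $A$.
   Context: Directed graphs are finite, without loops and without parallel arcs (arcs in opposite directions between two vertices are allowed); $uv$ or $u\to v$ denotes an arc from $u$ to $v$, and $G-uv$ is $G$ with the arc $uv$ removed. An arborescence of $G$ rooted in $r$ is a spanning tree of $G$ in which all arcs are oriented away from $r$. Two arborescences differ by an arc flip if they are equal on all arcs but one. Flipping in the arc $uv$ in an arborescence $T$ means removing the unique arc of $T$ entering $v$ and replacing it by $uv$, when this yields another arborescence. The flip graph $\mathcal{F}_r(G)$ is the undirected graph whose vertices are the arborescences of $G$ rooted in $r$, two of them being adjacent if they differ by an arc flip. For a directed graph $H$ rooted in $r$, a vertex $y$ is a descendant of a vertex $x$ in $H$ if every directed path from $r$ to $y$ in $H$ passes through $x$ (so $x$ is a descendant of itself). A directed graph $H'$ is built on a directed graph $H$ (both rooted in $r$) if $V(H')=V(H)$, $E(H)\subseteq E(H')$, and for every arc $x\to y$ in $E(H')\setminus E(H)$, $x$ is a descendant of $y$ in $H$. *)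

theory Defs
  imports "Graph_Theory.Digraph_Component"
begin

text \<open>
  A finite directed graph without loops and parallel arcs is a \<^locale>\<open>pair_digraph\<close>.

  \<^const>\<open>forest\<close> and \<^const>\<open>tree\<close> only exclude directed cycles (so an acyclic orientation of a
  triangle is a \<^const>\<open>tree\<close>), whereas the trees below are trees in the undirected sense.
  A walk in \<^term>\<open>mk_symmetric T\<close> that goes forth and back along one arc satisfies
  \<^const>\<open>pre_digraph.cycle\<close>, so only cycles of length at least 3 count. Antiparallel arcs, which
  \<^const>\<open>mk_symmetric\<close> merges, and loops are excluded separately.
\<close>

definition undirected_tree :: "'a pair_pre_digraph \<Rightarrow> bool" where
  "undirected_tree T \<longleftrightarrow>
     connected T \<and>
     (\<forall>x y. (x, y) \<in> parcs T \<longrightarrow> (y, x) \<notin> parcs T) \<and>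
     \<not> (\<exists>p. 3 \<le> length p \<and> pre_digraph.cycle (mk_symmetric T) p)"

text \<open>
  An arc \<open>x \<rightarrow> y\<close> of a tree is oriented away from \<open>r\<close> if the (unique) path of the underlying
  undirected tree from \<open>r\<close> to \<open>y\<close> ends by traversing this arc from \<open>x\<close> to \<open>y\<close>.
\<close>

definition oriented_away_from :: "'a \<Rightarrow> 'a pair_pre_digraph \<Rightarrow> bool" where
  "oriented_away_from r T \<longleftrightarrow>
     (\<forall>(x, y) \<in> parcs T. \<exists>p. pre_digraph.apath (mk_symmetric T) r (p @ [(x, y)]) y)"

definition arborescence :: "'a pair_pre_digraph \<Rightarrow> 'a \<Rightarrow> 'a pair_pre_digraph \<Rightarrow> bool" where
  "arborescence G r T \<longleftrightarrow>
     r \<in> pverts T \<and> spanning T G \<and> undirected_tree T \<and> oriented_away_from r T"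

definition differ_by_arc_flip :: "'a pair_pre_digraph \<Rightarrow> 'a pair_pre_digraph \<Rightarrow> bool" where
  "differ_by_arc_flip S T \<longleftrightarrow>
     card (parcs S - parcs T) = 1 \<and> card (parcs T - parcs S) = 1"

text \<open>
  If \<open>T\<close> is an arborescence and \<open>v\<close> is not its root, then \<^term>\<open>in_arcs T v\<close> is a singleton.
  Whether the result is again an arborescence is a separate matter.
\<close>

definition flip_in :: "'a \<Rightarrow> 'a \<Rightarrow> 'a pair_pre_digraph \<Rightarrow> 'a pair_pre_digraph" where
  "flip_in u v T = T\<lparr> parcs := insert (u, v) (parcs T - in_arcs T v) \<rparr>"

text \<open>
  Undirected graphs are symmetric digraphs, as in \<^locale>\<open>pair_graph\<close>; the degree of a vertex is
  then its \<^const>\<open>out_degree\<close>.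
\<close>

definition flip_graph :: "'a pair_pre_digraph \<Rightarrow> 'a \<Rightarrow> 'a pair_pre_digraph pair_pre_digraph" where
  "flip_graph G r = \<lparr>
     pverts = {T. arborescence G r T},
     parcs = {(S, T). arborescence G r S \<and> arborescence G r T \<and> differ_by_arc_flip S T} \<rparr>"

definition descendant :: "'a pair_pre_digraph \<Rightarrow> 'a \<Rightarrow> 'a \<Rightarrow> 'a \<Rightarrow> bool" where
  "descendant H r y x \<longleftrightarrow>
     x \<in> pverts H \<and> y \<in> pverts H \<and>
     (\<forall>p. pre_digraph.apath H r p y \<longrightarrow> x \<in> set (pre_digraph.awalk_verts H r p))"

definition built_on :: "'a \<Rightarrow> 'a pair_pre_digraph \<Rightarrow> 'a pair_pre_digraph \<Rightarrow> bool" where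
  "built_on r H' H \<longleftrightarrow>
     r \<in> pverts H \<and> pverts H' = pverts H \<and> parcs H \<subseteq> parcs H' \<and>
     (\<forall>(x, y) \<in> parcs H' - parcs H. descendant H r x y)"

definition remove_arc :: "'a pair_pre_digraph \<Rightarrow> 'a \<Rightarrow> 'a \<Rightarrow> 'a pair_pre_digraph" where
  "remove_arc G u v = G\<lparr> parcs := parcs G - {(u, v)} \<rparr>"

end

theory Submission
  imports Defs
begin

text \<open>
  A spanning subgraph is an arborescence rooted in \<open>r\<close> iff no arc enters \<open>r\<close>, at most one arc enters
  any vertex, and every vertex is reachable from \<open>r\<close>. Suppose an arc \<open>x \<rightarrow> y\<close> of \<open>G\<close> outside \<open>A\<close>
  violates the condition for being built on \<open>A\<close>, that is, some path of \<open>A\<close> from \<open>r\<close> to \<open>x\<close> avoids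
  \<open>y\<close>. That path survives the replacement of the arc of \<open>A\<close> entering \<open>y\<close> by \<open>x \<rightarrow> y\<close>, so flipping
  in \<open>x \<rightarrow> y\<close> yields a neighbour of \<open>A\<close>. As \<open>A\<close> has only one neighbour, \<open>x \<rightarrow> y\<close> is the arc \<open>u \<rightarrow> v\<close>.
\<close>

section \<open>Walks and cycles in symmetric digraphs\<close>

lemma (in pair_sym_digraph) awalk_reversed:
  assumes "awalk u p v"
  obtains q where "awalk v q u" "set (pawalk_verts v q) \<subseteq> set (pawalk_verts u p)"
proof -
  have "\<exists>q. awalk v q u \<and> set (pawalk_verts v q) \<subseteq> set (pawalk_verts u p)"
    using assms
  proof (induction p arbitrary: u)
    case Nil
    then show ?case by (intro exI[of _ "[]"]) (auto simp: awalk_simps)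
  next
    case (Cons e p)
    then have e: "e \<in> parcs G" "u = fst e" "awalk (snd e) p v" by (auto simp: awalk_simps)
    then obtain q where q: "awalk v q (snd e)" "set (pawalk_verts v q) \<subseteq> set (pawalk_verts (snd e) p)"
      using Cons.IH by blast
    have "(snd e, fst e) \<in> parcs G"
      using pair_sym_arcs e(1) by (cases e) (auto simp: symmetric_def dest: symD)
    then have s: "awalk (snd e) [(snd e, fst e)] u"
      using e by (auto simp: awalk_simps intro: arc_fst_in_verts)
    have "snd e \<in> set (pawalk_verts (snd e) p)"
      using hd_in_awalk_verts(1)[OF e(3)] .
    then show ?case
      using awalk_appendI[OF q(1) s] set_awalk_verts_append[OF q(1) s] q(2) e(2)
      by (intro exI[of _ "q @ [(snd e, fst e)]"]) auto
  qed
  then show thesis using that by blast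
qed

text \<open>Going back along \<open>p\<close> and out along \<open>p'\<close> leads from
  \<open>x\<close> to \<open>x'\<close> without meeting \<open>y\<close>. Shortened to a path, this
  closes up through \<open>y\<close>.\<close>

lemma (in pair_sym_digraph) apaths_distinct_last_arcs_imp_cycle:
  assumes p: "apath r (p @ [(x, y)]) y" and p': "apath r (p' @ [(x', y)]) y" and "x \<noteq> x'"
  shows "\<exists>c. 3 \<le> length c \<and> cycle c"
proof -
  have split: "awalk r q z \<and> (z, y) \<in> parcs G \<and> y \<notin> set (pawalk_verts r q)"
    if "apath r (q @ [(z, y)]) y" for q z
    using that awalk_verts_append[of r q "[(z, y)]" y] by (auto simp: apath_def awalk_simps)
  obtain q where q: "awalk x q r" "set (pawalk_verts x q) \<subseteq> set (pawalk_verts r p)"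
    using split[OF p] awalk_reversed by blast
  have w: "awalk x (q @ p') x'"
    using q(1) split[OF p'] by (auto intro: awalk_appendI)
  have av: "y \<notin> set (pawalk_verts x (q @ p'))"
    using set_awalk_verts_append[OF q(1)] split[OF p] split[OF p'] q(2) by blast
  define s where "s = awalk_to_apath (q @ p')"
  have s: "apath x s x'" unfolding s_def by (rule apath_awalk_to_apath[OF w])
  have "set s \<subseteq> set (q @ p')" unfolding s_def by (rule awalk_to_apath_subset[OF w])
  then have ys: "y \<notin> set (pawalk_verts x s)"
    using av set_awalk_verts[OF w] set_awalk_verts[OF awalkI_apath[OF s]] by auto
  have yx: "(y, x) \<in> parcs G"
    using pair_sym_arcs split[OF p] by (auto simp: symmetric_def dest: symD)
  have x'y: "awalk x' [(x', y)] y"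
    using split[OF p'] by (auto simp: awalk_simps intro: in_arcsD2)
  have sw: "awalk x (s @ [(x', y)]) y"
    using awalk_appendI[OF awalkI_apath[OF s] x'y] .
  have c: "awalk y ((y, x) # s @ [(x', y)]) y"
    using yx sw by (simp add: awalk_Cons_iff del: awalk_append_iff)
  have "pawalk_verts x (s @ [(x', y)]) = pawalk_verts x s @ [y]"
    using awalk_verts_append[OF sw] by simp
  then have "distinct (tl (pawalk_verts y ((y, x) # s @ [(x', y)])))"
    using s ys by (simp add: apath_def)
  then have "cycle ((y, x) # s @ [(x', y)])"
    using c unfolding cycle_def by blast
  \<comment> \<open>Together with the two arcs at \<open>y\<close>, one arc in \<open>s\<close> is
    enough to reach the length 3 demanded in \<open>undirected_tree\<close>.\<close>
  moreover have "s \<noteq> []" using s \<open>x \<noteq> x'\<close> by (auto simp: apath_Nil_iff)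
  then have "3 \<le> length ((y, x) # s @ [(x', y)])" by (cases s) auto
  ultimately show ?thesis by blast
qed

lemma (in pair_wf_digraph) cycle_rotated_to:
  assumes "cycle c" "e \<in> set c"
  obtains c' where "awalk (snd e) (c' @ [e]) (snd e)" "distinct (map snd (c' @ [e]))"
    "length c = length (c' @ [e])" "set c = set (c' @ [e])"
proof -
  obtain u where u: "awalk u c u" "distinct (tl (pawalk_verts u c))" "c \<noteq> []"
    using assms by (auto simp: cycle_def)
  obtain c1 c2 where c: "c = c1 @ e # c2" using assms(2) by (auto simp: in_set_conv_decomp)
  \<comment> \<open>In terms of heads of arcs, distinctness no longer depends on the starting vertex
    and survives rotation.\<close>
  have "tl (pawalk_verts u c) = map snd c"
    using awalk_verts_conv'[of u c u] u by (auto simp: awalk_def)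
  then have d: "distinct (map snd c)" using u by simp
  have "awalk u c1 (fst e)" "awalk (snd e) c2 u" "e \<in> parcs G"
    using u(1) c by (auto simp: awalk_Cons_iff)
  moreover from this have "awalk (fst e) [e] (snd e)"
    by (auto simp: awalk_simps intro: arc_snd_in_verts)
  ultimately have "awalk (snd e) ((c2 @ c1) @ [e]) (snd e)"
    by (intro awalk_appendI)
  moreover have "distinct (map snd ((c2 @ c1) @ [e]))" using d c by auto
  ultimately show thesis using that[of "c2 @ c1"] c by auto
qed

section \<open>Arborescences described by directed reachability\<close>

text \<open>Directed cycles are excluded implicitly: such a cycle would avoid \<open>r\<close>, so a
  path from \<open>r\<close> would have to enter it at a vertex that already has an arc entering it
  from the cycle.\<close>

definition rooted_tree :: "'a \<Rightarrow> 'a pair_pre_digraph \<Rightarrow> bool" where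
  "rooted_tree r T \<longleftrightarrow>
     pair_wf_digraph T \<and> r \<in> pverts T \<and> (\<forall>x. (x, r) \<notin> parcs T) \<and>
     (\<forall>x x' y. (x, y) \<in> parcs T \<longrightarrow> (x', y) \<in> parcs T \<longrightarrow> x = x') \<and>
     (\<forall>v \<in> pverts T. (r, v) \<in> (parcs T)\<^sup>*)"

lemma pair_sym_digraph_mk_symmetric:
  assumes "pair_wf_digraph T"
  shows "pair_sym_digraph (mk_symmetric (with_proj T))"
proof -
  interpret T: pair_wf_digraph T by fact
  interpret S: pair_wf_digraph "mk_symmetric T" by (rule T.wellformed_mk_symmetric)
  show ?thesis by unfold_locales (rule symmetric_mk_symmetric)
qed

lemma parcs_mk_symmetric_pair: "parcs (mk_symmetric (with_proj T)) = parcs T \<union> (parcs T)\<inverse>"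
  by (auto simp: parcs_mk_symmetric)

text \<open>Without cycles, all paths from \<open>r\<close> to a vertex end with the same arc. This
  makes parents unique, and it forces paths from \<open>r\<close> in the underlying tree to use the
  arcs of \<open>T\<close> forwards only.\<close>

lemma rooted_tree_if_oriented_undirected_tree:
  assumes wf: "pair_wf_digraph T" and r: "r \<in> pverts T"
    and tree: "undirected_tree T" and ori: "oriented_away_from r T"
  shows "rooted_tree r T"
proof -
  interpret S: pair_sym_digraph "mk_symmetric T" by (rule pair_sym_digraph_mk_symmetric[OF wf])
  have ori': "\<exists>p. S.apath r (p @ [(x, y)]) y" if "(x, y) \<in> parcs T" for x y
    using ori that by (auto simp: oriented_away_from_def)
  have last_unique: "x = x'" if "S.apath r (p @ [(x, y)]) y" "S.apath r (p' @ [(x', y)]) y" for p p' x x' y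
    using S.apaths_distinct_last_arcs_imp_cycle[OF that] tree by (auto simp: undirected_tree_def)
  have no_in: "(x, r) \<notin> parcs T" for x
    using ori'[of x r] S.apath_nonempty_ends by blast
  have path_reach: "S.apath r p w \<Longrightarrow> (r, w) \<in> (parcs T)\<^sup>*" for p w
  proof (induction p arbitrary: w rule: rev_induct)
    case Nil
    then show ?case by (simp add: S.apath_Nil_iff)
  next
    case (snoc e p)
    obtain a where e: "e = (a, w)"
      using snoc.prems by (cases e) (auto simp: S.apath_append_iff S.apath_simps)
    have p: "S.apath r p a" "(a, w) \<in> parcs (mk_symmetric T)" "w \<notin> set (pawalk_verts r p)"
      using snoc.prems e by (auto simp: S.apath_append_iff S.apath_simps)
    \<comment> \<open>If the last arc were traversed backwards, the orientation of
      \<open>(w, a)\<close> would give a path to \<open>a\<close> ending with that arc. By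
      uniqueness of last arcs \<open>p\<close> would then enter \<open>a\<close> from
      \<open>w\<close> too, so \<open>w\<close> would be visited twice.\<close>
    have "(w, a) \<notin> parcs T"
    proof
      assume wa: "(w, a) \<in> parcs T"
      then obtain q where q: "S.apath r (q @ [(w, a)]) a" using ori' by blast
      show False
      proof (cases p rule: rev_cases)
        case Nil
        then show False using p(1) wa no_in by (simp add: S.apath_Nil_iff)
      next
        case (snoc p0 f)
        then obtain b where f: "f = (b, a)"
          using p(1) by (cases f) (auto simp: S.apath_append_iff S.apath_simps)
        then have "w = b" using last_unique[OF q] p(1) snoc by blast
        moreover have "b \<in> set (pawalk_verts r p)"
          using S.awalk_verts_arc1[of f p r] f snoc by simp
        ultimately show False using p(3) by simp
      qed
    qed
    then have "(a, w) \<in> parcs T" using p(2) by (auto simp: parcs_mk_symmetric_pair)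
    then show ?case using snoc.IH[OF p(1)] by (rule rtrancl_into_rtrancl[rotated])
  qed
  have "(r, v) \<in> (parcs T)\<^sup>*" if "v \<in> pverts T" for v
  proof -
    have "r \<rightarrow>\<^sup>*\<^bsub>with_proj (mk_symmetric T)\<^esub> v"
      using tree that r by (auto simp: undirected_tree_def connected_def strongly_connected_def)
    then show ?thesis using path_reach by (auto simp: S.reachable_apath)
  qed
  moreover have "x = x'" if "(x, y) \<in> parcs T" "(x', y) \<in> parcs T" for x x' y
    using ori'[OF that(1)] ori'[OF that(2)] last_unique by blast
  ultimately show ?thesis using no_in wf r by (auto simp: rooted_tree_def)
qed

text \<open>The depth is the distance from \<open>r\<close>: since \<open>x\<close> is the only
  parent of \<open>y\<close>, a shortest path to \<open>y\<close> has \<open>x\<close> as its last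
  vertex but one.\<close>

lemma rooted_tree_depth:
  assumes "rooted_tree r T"
  obtains d :: "'a \<Rightarrow> nat" where "\<And>x y. (x, y) \<in> parcs T \<Longrightarrow> d y = Suc (d x)"
proof
  define d where "d v = (LEAST n. (r, v) \<in> parcs T ^^ n)" for v
  interpret pair_wf_digraph T using assms by (simp add: rooted_tree_def)
  have d: "(r, v) \<in> parcs T ^^ d v" if "v \<in> pverts T" for v
    unfolding d_def
    using assms that by (auto simp: rooted_tree_def rtrancl_power intro: LeastI)
  have d_le: "d v \<le> n" if "(r, v) \<in> parcs T ^^ n" for v n
    unfolding d_def using that by (rule Least_le)
  fix x y assume xy: "(x, y) \<in> parcs T"
  then have V: "x \<in> pverts T" "y \<in> pverts T" by (auto dest: in_arcsD1 in_arcsD2)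
  have "d y \<le> Suc (d x)"
    using d[OF V(1)] xy by (intro d_le) auto
  moreover have "Suc (d x) \<le> d y"
  proof (cases "d y")
    case 0
    then have "y = r" using d[OF V(2)] by simp
    then show ?thesis using xy assms by (auto simp: rooted_tree_def)
  next
    case (Suc m)
    then obtain z where "(r, z) \<in> parcs T ^^ m" "(z, y) \<in> parcs T"
      using d[OF V(2)] by auto
    moreover from this have "z = x" using xy assms unfolding rooted_tree_def by blast
    ultimately show ?thesis using d_le Suc by simp
  qed
  ultimately show "d y = Suc (d x)" by simp
qed

text \<open>Depth rules out antiparallel arcs and cycles; connectedness holds because every vertex
  is joined to \<open>r\<close>.\<close>

lemma undirected_tree_if_rooted_tree:
  assumes T: "rooted_tree r T"
  shows "undirected_tree T"
proof -
  interpret T: pair_wf_digraph T using T by (simp add: rooted_tree_def)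
  interpret S: pair_sym_digraph "mk_symmetric T"
    by (rule pair_sym_digraph_mk_symmetric) unfold_locales
  obtain d :: "'a \<Rightarrow> nat" where d: "\<And>x y. (x, y) \<in> parcs T \<Longrightarrow> d y = Suc (d x)"
    using rooted_tree_depth[OF T] by blast
  have parent_unique: "x = x'" if "(x, y) \<in> parcs T" "(x', y) \<in> parcs T" for x x' y
    using T that unfolding rooted_tree_def by blast
  have no_cycle: False if c: "3 \<le> length c" "S.cycle c" for c
  proof -
    text \<open>Both neighbours of a deepest vertex of the cycle would be its parent.\<close>
    have "c \<noteq> []" using c(1) by auto
    then obtain e where e: "e \<in> set c" and max: "\<And>f. f \<in> set c \<Longrightarrow> d (snd f) \<le> d (snd e)"
      using Max_in[of "(d \<circ> snd) ` set c"] Max_ge[of "(d \<circ> snd) ` set c"]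
      by (smt (verit) List.finite_set comp_apply empty_iff finite_imageI imageE image_eqI
          image_is_empty set_empty)
    \<comment> \<open>The maximum was taken over heads; on a closed walk every tail is also a
      head.\<close>
    have c_verts: "d (fst f) \<le> d (snd e)" if "f \<in> set c" for f
    proof -
      obtain u where u: "S.awalk u c u" using c(2) by (auto simp: S.cycle_def)
      have "u \<in> snd ` set c"
        using u \<open>c \<noteq> []\<close> by (cases c rule: rev_cases) (auto simp: S.awalk_simps)
      moreover have "pawalk_verts u c = u # map snd c"
        using S.awalk_verts_conv'[of u c u] u \<open>c \<noteq> []\<close> by (cases c) (auto simp: S.awalk_def)
      ultimately have "fst f \<in> snd ` set c"
        using S.awalk_verts_arc1[OF that, of u] by auto
      then show ?thesis using max by auto
    qed
    \<comment> \<open>The opposite orientation would make \<open>a\<close> deeper than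
      \<open>snd e\<close>.\<close>
    have up: "(a, snd e) \<in> parcs T" if "(a, snd e) \<in> parcs (mk_symmetric T)" "d a \<le> d (snd e)" for a
      using that d[of "snd e" a] by (auto simp: parcs_mk_symmetric_pair)
    \<comment> \<open>With \<open>e\<close> last, the cycle starts and ends at the deepest vertex,
      so its two neighbours there are \<open>snd f\<close> and \<open>fst e\<close>.\<close>
    obtain c' where c': "S.awalk (snd e) (c' @ [e]) (snd e)" "distinct (map snd (c' @ [e]))"
      "length c = length (c' @ [e])" "set c = set (c' @ [e])"
      using S.cycle_rotated_to[OF c(2) e] .
    obtain f s where f: "c' = f # s" using c'(3) c(1) by (cases c') auto
    have "s \<noteq> []" using c'(3) c(1) f by auto
    have "fst f = snd e" "f \<in> parcs (mk_symmetric T)" using c'(1) f by (auto simp: S.awalk_Cons_iff)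
    then have 1: "(snd f, snd e) \<in> parcs T"
      using up[of "snd f"] max[of f] c'(4) f by (cases f) (auto simp: parcs_mk_symmetric_pair)
    have "e \<in> parcs (mk_symmetric T)" using c'(1) by (auto simp: S.awalk_simps)
    then have 2: "(fst e, snd e) \<in> parcs T" using up[of "fst e"] c_verts[OF e] by simp
    have "fst e = snd (last s)"
      using c'(1) f \<open>s \<noteq> []\<close> by (cases s rule: rev_cases) (auto simp: S.awalk_simps)
    \<comment> \<open>Length at least 3 puts an arc between \<open>f\<close> and \<open>e\<close>;
      its head \<open>fst e\<close> differs from \<open>snd f\<close> because heads are
      distinct.\<close>
    then have "snd f \<noteq> fst e" using c'(2) f \<open>s \<noteq> []\<close> by auto
    then show False using parent_unique[OF 1 2] by simp
  qed
  have reach: "r \<rightarrow>\<^sup>*\<^bsub>with_proj (mk_symmetric T)\<^esub> v" if "v \<in> pverts T" for v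
  proof -
    have "(r, v) \<in> (parcs T)\<^sup>*" using T that by (simp add: rooted_tree_def)
    then show ?thesis
    proof induction
      case base
      then show ?case using T by (auto simp: rooted_tree_def)
    next
      case (step y z)
      then show ?case
        by (intro S.reachable_adj_trans[OF step.IH]) (auto simp: parcs_mk_symmetric_pair)
    qed
  qed
  have "connected T"
    unfolding connected_def strongly_connected_def
  proof (intro conjI ballI)
    show "verts (mk_symmetric T) \<noteq> {}" using T by (auto simp: rooted_tree_def)
    fix u v assume "u \<in> verts (mk_symmetric T)" "v \<in> verts (mk_symmetric T)"
    then show "u \<rightarrow>\<^sup>*\<^bsub>with_proj (mk_symmetric T)\<^esub> v"
      using S.reachable_trans[OF symmetric_reachable[OF S.pair_sym_arcs reach] reach] by simp
  qed
  moreover have "(y, x) \<notin> parcs T" if "(x, y) \<in> parcs T" for x y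
    using d[OF that] d[of y x] by linarith
  ultimately show ?thesis using no_cycle by (auto simp: undirected_tree_def)
qed

text \<open>Depth grows along every arc, so a directed walk in \<open>T\<close> repeats no vertex
  and is a path of the underlying graph.\<close>

lemma oriented_away_from_if_rooted_tree:
  assumes T: "rooted_tree r T"
  shows "oriented_away_from r T"
proof -
  interpret T: pair_wf_digraph T using T by (simp add: rooted_tree_def)
  interpret S: pair_sym_digraph "mk_symmetric T"
    by (rule pair_sym_digraph_mk_symmetric) unfold_locales
  obtain d :: "'a \<Rightarrow> nat" where d: "\<And>x y. (x, y) \<in> parcs T \<Longrightarrow> d y = Suc (d x)"
    using rooted_tree_depth[OF T] by blast
  \<comment> \<open>The depth bound strengthens the induction: the tail of a prepended arc is
    strictly less deep than all vertices that follow.\<close>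
  have walk: "S.apath u p v \<and> (\<forall>w \<in> set (pawalk_verts u p). d u \<le> d w)" if "T.awalk u p v" for u p v
    using that
  proof (induction p arbitrary: u)
    case Nil
    then show ?case by (auto simp: T.awalk_simps S.apath_simps)
  next
    case (Cons e p)
    then have e: "e \<in> parcs T" "u = fst e" "T.awalk (snd e) p v" by (auto simp: T.awalk_simps)
    have "d (snd e) = Suc (d (fst e))" using d[of "fst e" "snd e"] e by simp
    then show ?case using Cons.IH[OF e(3)] e
      by (fastforce simp: S.apath_simps parcs_mk_symmetric_pair)
  qed
  have "\<exists>p. S.apath r (p @ [(x, y)]) y" if xy: "(x, y) \<in> parcs T" for x y
  proof -
    have "x \<in> pverts T" "y \<in> pverts T" using xy by (auto dest: T.in_arcsD1 T.in_arcsD2)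
    have "(r, x) \<in> (parcs T)\<^sup>*" using T \<open>x \<in> pverts T\<close> by (simp add: rooted_tree_def)
    then have "r \<rightarrow>\<^sup>*\<^bsub>with_proj T\<^esub> x"
    proof induction
      case base
      then show ?case using T by (auto simp: rooted_tree_def)
    next
      case (step y z)
      then show ?case by (intro T.reachable_adj_trans[OF step.IH]) auto
    qed
    then obtain p where "T.awalk r p x" by (auto simp: T.reachable_awalk)
    moreover have "T.awalk x [(x, y)] y" using xy \<open>y \<in> pverts T\<close> by (simp add: T.awalk_simps)
    ultimately have "T.awalk r (p @ [(x, y)]) y" by (rule T.awalk_appendI)
    then show ?thesis using walk by blast
  qed
  then show ?thesis by (auto simp: oriented_away_from_def)
qed

text \<open>Lets the flip lemmas check entering arcs and reachability instead of undirected trees.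
  Well-formedness of \<open>T\<close> comes from \<open>spanning T G\<close>.\<close>

lemma arborescence_iff_rooted_tree:
  "arborescence G r T \<longleftrightarrow> spanning T G \<and> rooted_tree r T"
proof -
  have "pair_wf_digraph T" if "spanning T G"
    using that by (auto simp: spanning_def subgraph_def wf_digraph_wp_iff)
  then show ?thesis
    using rooted_tree_if_oriented_undirected_tree undirected_tree_if_rooted_tree
      oriented_away_from_if_rooted_tree
    unfolding arborescence_def by (metis rooted_tree_def)
qed

section \<open>Flipping in an arc\<close>

lemma parcs_flip_in: "parcs (flip_in x y T) = insert (x, y) {e \<in> parcs T. snd e \<noteq> y}"
  by (auto simp: flip_in_def in_arcs_def)

lemma pverts_flip_in [simp]: "pverts (flip_in x y T) = pverts T"
  by (simp add: flip_in_def)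

text \<open>Only arcs entering \<open>y\<close> are lost, so \<open>p\<close> still reaches
  \<open>x\<close>, and the new arc leads on to \<open>y\<close>. Any other vertex keeps its
  entering arc and stays reachable by induction along a path of \<open>T\<close>.\<close>

lemma rooted_tree_flip_in:
  assumes T: "rooted_tree r T" and "x \<in> pverts T" "y \<in> pverts T"
    and path: "pre_digraph.apath T r p x" and avoid: "y \<notin> set (pawalk_verts r p)"
  shows "rooted_tree r (flip_in x y T)"
proof -
  interpret T: pair_wf_digraph T using T by (simp add: rooted_tree_def)
  let ?R = "parcs (flip_in x y T)"
  have "(w, z) \<in> ?R\<^sup>*" if "T.awalk w q z" "y \<notin> set (pawalk_verts w q)" for w q z
    using that
  proof (induction q arbitrary: w)
    case Nil
    then show ?case by (simp add: T.awalk_simps)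
  next
    case (Cons e q)
    then have e: "e \<in> parcs T" "w = fst e" "T.awalk (snd e) q z" by (auto simp: T.awalk_simps)
    then have "snd e \<noteq> y" using Cons.prems(2) T.hd_in_awalk_verts(1)[OF e(3)] by auto
    then have "(w, snd e) \<in> ?R" using e by (simp add: parcs_flip_in)
    moreover have "(snd e, z) \<in> ?R\<^sup>*"
      using Cons.IH[OF e(3)] Cons.prems(2) by simp
    ultimately show ?case by (rule converse_rtrancl_into_rtrancl)
  qed
  then have rx: "(r, x) \<in> ?R\<^sup>*" using path avoid by (auto simp: T.apath_def)
  have reach: "(r, v) \<in> ?R\<^sup>*" if "v \<in> pverts T" for v
  proof -
    have "(r, v) \<in> (parcs T)\<^sup>*" using T that by (simp add: rooted_tree_def)
    then show ?thesis
    proof induction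
      case base
      then show ?case by simp
    next
      case (step w z)
      show ?case
      proof (cases "z = y")
        case True
        then show ?thesis using rx by (auto simp: parcs_flip_in intro: rtrancl_into_rtrancl)
      next
        case False
        then have "(w, z) \<in> ?R" using step by (simp add: parcs_flip_in)
        then show ?thesis using step.IH by (auto intro: rtrancl_into_rtrancl)
      qed
    qed
  qed
  \<comment> \<open>\<open>p\<close> starts at \<open>r\<close> and avoids \<open>y\<close>; hence
    the new arc does not enter the root.\<close>
  have "r \<noteq> y" using T.hd_in_awalk_verts(2)[OF path] avoid by auto
  moreover have "pair_wf_digraph (flip_in x y T)"
    using assms(2,3)
    by unfold_locales (auto simp: parcs_flip_in intro: T.arc_fst_in_verts T.arc_snd_in_verts
        dest: T.in_arcsD1 T.in_arcsD2)
  ultimately show ?thesis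
    using T reach by (auto simp: rooted_tree_def parcs_flip_in)
qed

text \<open>The single arc \<open>(w, y)\<close> entering \<open>y\<close> is exchanged for
  \<open>(x, y)\<close>, and these differ because \<open>(x, y)\<close> is not in
  \<open>T\<close>.\<close>

lemma differ_by_arc_flip_flip_in:
  assumes T: "rooted_tree r T" and "y \<in> pverts T" "y \<noteq> r" "(x, y) \<notin> parcs T"
  shows "differ_by_arc_flip T (flip_in x y T)"
proof -
  have "(r, y) \<in> (parcs T)\<^sup>*" using assms by (simp add: rooted_tree_def)
  then obtain w where w: "(w, y) \<in> parcs T" using \<open>y \<noteq> r\<close> by (auto elim: rtranclE)
  have "{e \<in> parcs T. snd e = y} = {(w, y)}"
    using T w unfolding rooted_tree_def by force
  then have "parcs T - parcs (flip_in x y T) = {(w, y)}"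
    using assms(4) by (auto simp: parcs_flip_in)
  moreover have "parcs (flip_in x y T) - parcs T = {(x, y)}"
    using assms(4) by (auto simp: parcs_flip_in)
  ultimately show ?thesis by (simp add: differ_by_arc_flip_def)
qed

lemma spanning_flip_in:
  fixes G T :: "'a pair_pre_digraph"
  assumes "spanning T G" "(x, y) \<in> parcs G"
  shows "spanning (flip_in x y T) G"
proof -
  have G: "pair_wf_digraph G" and sub: "parcs T \<subseteq> parcs G" and V: "pverts T = pverts G"
    using assms by (auto simp: spanning_def subgraph_def wf_digraph_wp_iff)
  interpret pair_wf_digraph G by (fact G)
  have "pair_wf_digraph (flip_in x y T)"
    using sub V assms(2) by unfold_locales (auto simp: parcs_flip_in
        intro!: arc_fst_in_verts arc_snd_in_verts dest: in_arcsD1 in_arcsD2)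
  then show ?thesis
    using G sub V assms(2)
    by (auto simp: spanning_def subgraph_def wf_digraph_wp_iff compatible_def parcs_flip_in)
qed

text \<open>Failure of \<open>descendant\<close> supplies exactly the path to \<open>x\<close>
  avoiding \<open>y\<close> along which the flipped tree remains connected to
  \<open>r\<close>.\<close>

lemma flip_in_adjacent:
  fixes G :: "'a pair_pre_digraph"
  assumes A: "arborescence G r A" and xy: "(x, y) \<in> parcs G - parcs A"
    and nd: "\<not> descendant A r x y"
  shows "(A, flip_in x y A) \<in> parcs (flip_graph G r)"
proof -
  have sp: "spanning A G" and T: "rooted_tree r A" using A by (auto simp: arborescence_iff_rooted_tree)
  interpret A: pair_wf_digraph A using T by (simp add: rooted_tree_def)
  interpret G: pair_wf_digraph G
    using sp by (auto simp: spanning_def subgraph_def wf_digraph_wp_iff)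
  have V: "x \<in> pverts A" "y \<in> pverts A"
    using xy sp by (auto simp: spanning_def dest: G.in_arcsD1 G.in_arcsD2)
  obtain p where p: "A.apath r p x" "y \<notin> set (pawalk_verts r p)"
    using nd V by (auto simp: descendant_def)
  have "y \<noteq> r" using A.hd_in_awalk_verts(2)[OF p(1)] p(2) by auto
  then show ?thesis
    using A spanning_flip_in[OF sp, of x y] rooted_tree_flip_in[OF T V p] xy
      differ_by_arc_flip_flip_in[OF T V(2), of x]
    by (auto simp: flip_graph_def arborescence_iff_rooted_tree)
qed

theorem mainTheorem5:
  fixes G A :: "'a pair_pre_digraph" and r u v :: 'a
  assumes "pair_digraph G"
    and "r \<in> pverts G"
    and "arborescence G r A"
    and "out_degree (flip_graph G r) A = 1"
    and "(u, v) \<in> parcs G"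
    and "(A, flip_in u v A) \<in> parcs (flip_graph G r)"
  shows "built_on r (remove_arc G u v) A"
proof -
  have sub: "parcs A \<subseteq> parcs G" "pverts A = pverts G"
    using assms(3) by (auto simp: arborescence_def spanning_def subgraph_def)
  \<comment> \<open>The flip really adds an arc, which can only be \<open>(u, v)\<close>. So
    \<open>(u, v)\<close> lies outside \<open>A\<close>, and removing it from \<open>G\<close>
    leaves \<open>A\<close> a subgraph.\<close>
  have "card (parcs (flip_in u v A) - parcs A) = 1"
    using assms(6) by (simp add: flip_graph_def differ_by_arc_flip_def)
  then obtain e where "e \<in> parcs (flip_in u v A) - parcs A"
    by (metis card_1_singletonE insertI1)
  then have uv: "(u, v) \<notin> parcs A"
    by (auto simp: parcs_flip_in)
  have "descendant A r x y" if xy: "(x, y) \<in> parcs G - {(u, v)} - parcs A" for x y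
  proof (rule ccontr)
    assume "\<not> descendant A r x y"
    then have "(A, flip_in x y A) \<in> out_arcs (flip_graph G r) A"
      using flip_in_adjacent[OF assms(3)] xy by simp
    moreover have "(A, flip_in u v A) \<in> out_arcs (flip_graph G r) A"
      using assms(6) by simp
    ultimately have "flip_in x y A = flip_in u v A"
      using assms(4) by (metis card_1_singletonE out_degree_def prod.inject singletonD)
    \<comment> \<open>Equal flips add equal arcs: \<open>(u, v)\<close> is the only arc of
      \<open>flip_in u v A\<close> that can lie outside \<open>A\<close>, which contradicts the
      choice of \<open>(x, y)\<close>.\<close>
    then have "(x, y) \<in> parcs (flip_in u v A)" by (metis insertI1 parcs_flip_in)
    then show False using xy by (auto simp: parcs_flip_in)
  qed
  then show ?thesis
    using assms(2) sub uv by (auto simp: built_on_def remove_arc_def)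
qed

end
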